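(* If there exist $N\in\mathcal{I}$ and a constant $K$ such that $$\left|\frac{c(t)}{p(t)}\right|\le K\ \text{ for } t>N,\qquad\text{and}\qquad \sum_{t=N}^{\infty}\frac{1}{|p(t)|}=\infty,$$ then $\mathcal{L}$ is in the limit point case (LPC) at $t=\infty$.
   Context: Let $a\in\mathbb{Z}$, $\mathcal{I}=\{a,a+1,\dots\}$, $\mathcal{I}'=\{a-1,a,a+1,\dots\}$. $\nabla y(t)=y(t)-y(t-1)$, $\Delta y(t)=y(t+1)-y(t)$. Let $p,q,c,h,d:\mathcal{I}'\to\mathbb{R}$ with $p(t)\ne0$ for all $t$. For $\lambda\in\mathbb{C}$, $(E_\lambda)$ (abbreviated $\mathcal{L}(y)=\lambda y$) is the system for $y=(y_1,y_2)^{\mathrm T}:\mathcal{I}'\to\mathbb{C}^2$: $$-\nabla(p(t)\Delta y_1(t))+q(t)y_1(t)-\nabla(c(t)y_2(t))+h(t)y_2(t)=\lambda y_1(t),\quad t\in\mathcal{I},$$ $$c(t)\Delta y_1(t)+h(t)y_1(t)+d(t)y_2(t)=\lambda y_2(t),\quad t\in\mathcal{I}'.$$ $y^{[1]}(t)=p(t)\Delta y_1(t)+c(t)y_2(t)$, $t\in\mathcal{I}'$. Weyl circles and LPC. For $\lambda\in\mathbb{C}\setminus\mathbb{R}$ and $\alpha\in[0,\pi)$ let $\varphi,\psi$ be the (unique) solutions of $(E_\lambda)$ with $\varphi_1(a)=\sin\alpha$, $\varphi^{[1]}(a-1)=-\cos\alpha$, $\psi_1(a)=\cos\alpha$, $\psi^{[1]}(a-1)=\sin\alpha$.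 For an integer $N>a$ and $\beta\in[0,\pi)$ put $U_2(y)=y_1(N+1)\cos\beta+y^{[1]}(N)\sin\beta$. As $\beta$ ranges over $[0,\pi)$, the points $m=-U_2(\varphi)/U_2(\psi)$ describe a circle $C_N$ in $\mathbb{C}$; the closed discs bounded by $C_N$ decrease as $N$ increases. The sequence $\{C_N\}$ is said to converge to a point if the intersection of these closed discs is a single point (otherwise it is a closed disc of positive radius). $\mathcal{L}$ is in the LPC at $t=\infty$ if $\{C_N\}$ converges to a point, for every $\lambda\in\mathbb{C}\setminus\mathbb{R}$ and every $\alpha\in[0,\pi)$. *)

theory Defs
  imports "HOL-Analysis.Analysis"
begin

text \<open>
  Sequences on \<open>\<I>' = {a - 1, a, a + 1, \<dots>}\<close> are functions on \<open>int\<close>, of which only the values at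
  \<open>t \<ge> a - 1\<close> matter; a \<open>\<complex>\<^sup>2\<close>-valued sequence \<open>y\<close> has components \<open>y1 = fst \<circ> y\<close> and
  \<open>y2 = snd \<circ> y\<close>.
\<close>

definition bdiff :: "(int \<Rightarrow> 'a::ab_group_add) \<Rightarrow> int \<Rightarrow> 'a" where
  "bdiff f t = f t - f (t - 1)"

definition fdiff :: "(int \<Rightarrow> 'a::ab_group_add) \<Rightarrow> int \<Rightarrow> 'a" where
  "fdiff f t = f (t + 1) - f t"

definition is_solution ::
  "int \<Rightarrow> (int \<Rightarrow> real) \<Rightarrow> (int \<Rightarrow> real) \<Rightarrow> (int \<Rightarrow> real) \<Rightarrow> (int \<Rightarrow> real) \<Rightarrow> (int \<Rightarrow> real)
    \<Rightarrow> complex \<Rightarrow> (int \<Rightarrow> complex \<times> complex) \<Rightarrow> bool" where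
  "is_solution a p q c h d \<mu> y \<longleftrightarrow>
    (\<forall>t\<ge>a. - bdiff (\<lambda>s. complex_of_real (p s) * fdiff (\<lambda>r. fst (y r)) s) t
             + complex_of_real (q t) * fst (y t)
             - bdiff (\<lambda>s. complex_of_real (c s) * snd (y s)) t
             + complex_of_real (h t) * snd (y t) = \<mu> * fst (y t)) \<and>
    (\<forall>t\<ge>a - 1. complex_of_real (c t) * fdiff (\<lambda>r. fst (y r)) t
             + complex_of_real (h t) * fst (y t)
             + complex_of_real (d t) * snd (y t) = \<mu> * snd (y t))"

definition quasi_diff ::
  "(int \<Rightarrow> real) \<Rightarrow> (int \<Rightarrow> real) \<Rightarrow> (int \<Rightarrow> complex \<times> complex) \<Rightarrow> int \<Rightarrow> complex" where
  "quasi_diff p c y t =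
     complex_of_real (p t) * fdiff (\<lambda>r. fst (y r)) t + complex_of_real (c t) * snd (y t)"

text \<open>
  The solution with \<open>y1(a) = u\<close> and \<open>y\<^sup>[\<^sup>1\<^sup>](a - 1) = v\<close>. It is unique on \<open>\<I>'\<close>; the value
  \<open>0\<close> outside \<open>\<I>'\<close> is a convention making it unique as a function on \<open>int\<close>. The description is
  proper for nonreal \<open>\<mu>\<close> and nonvanishing \<open>p\<close>, see \<open>ivp_solution_ex1\<close> below.
\<close>

definition ivp_solution ::
  "int \<Rightarrow> (int \<Rightarrow> real) \<Rightarrow> (int \<Rightarrow> real) \<Rightarrow> (int \<Rightarrow> real) \<Rightarrow> (int \<Rightarrow> real) \<Rightarrow> (int \<Rightarrow> real)
    \<Rightarrow> complex \<Rightarrow> complex \<Rightarrow> complex \<Rightarrow> int \<Rightarrow> complex \<times> complex" where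
  "ivp_solution a p q c h d \<mu> u v =
    (THE y. is_solution a p q c h d \<mu> y \<and> fst (y a) = u \<and> quasi_diff p c y (a - 1) = v \<and>
            (\<forall>t<a - 1. y t = (0, 0)))"

definition weyl_phi where
  "weyl_phi a p q c h d \<mu> \<alpha> =
    ivp_solution a p q c h d \<mu> (complex_of_real (sin \<alpha>)) (- complex_of_real (cos \<alpha>))"

definition weyl_psi where
  "weyl_psi a p q c h d \<mu> \<alpha> =
    ivp_solution a p q c h d \<mu> (complex_of_real (cos \<alpha>)) (complex_of_real (sin \<alpha>))"

definition bc_U2 ::
  "(int \<Rightarrow> real) \<Rightarrow> (int \<Rightarrow> real) \<Rightarrow> int \<Rightarrow> real \<Rightarrow> (int \<Rightarrow> complex \<times> complex) \<Rightarrow> complex" where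
  "bc_U2 p c N \<beta> y =
     fst (y (N + 1)) * complex_of_real (cos \<beta>) + quasi_diff p c y N * complex_of_real (sin \<beta>)"

definition weyl_circle ::
  "int \<Rightarrow> (int \<Rightarrow> real) \<Rightarrow> (int \<Rightarrow> real) \<Rightarrow> (int \<Rightarrow> real) \<Rightarrow> (int \<Rightarrow> real) \<Rightarrow> (int \<Rightarrow> real)
    \<Rightarrow> complex \<Rightarrow> real \<Rightarrow> int \<Rightarrow> complex set" where
  "weyl_circle a p q c h d \<mu> \<alpha> N =
    {- bc_U2 p c N \<beta> (weyl_phi a p q c h d \<mu> \<alpha>) / bc_U2 p c N \<beta> (weyl_psi a p q c h d \<mu> \<alpha>) | \<beta>.
       0 \<le> \<beta> \<and> \<beta> < pi}"

text \<open>The closed disc bounded by a circle \<open>C\<close>; it is empty if \<open>C\<close> is not a circle.\<close>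

definition bounded_disc :: "complex set \<Rightarrow> complex set" where
  "bounded_disc C = \<Union>{cball z r | z r. r > 0 \<and> sphere z r = C}"

definition limit_point_case ::
  "int \<Rightarrow> (int \<Rightarrow> real) \<Rightarrow> (int \<Rightarrow> real) \<Rightarrow> (int \<Rightarrow> real) \<Rightarrow> (int \<Rightarrow> real) \<Rightarrow> (int \<Rightarrow> real) \<Rightarrow> bool" where
  "limit_point_case a p q c h d \<longleftrightarrow>
    (\<forall>\<mu> \<alpha>. \<mu> \<notin> \<real> \<longrightarrow> 0 \<le> \<alpha> \<longrightarrow> \<alpha> < pi \<longrightarrow>
       (\<exists>m. (\<Inter>N\<in>{a<..}. bounded_disc (weyl_circle a p q c h d \<mu> \<alpha> N)) = {m}))"

text \<open>Well-definedness of \<open>ivp_solution\<close>.\<close>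

lemma linear_system_ex1:
  fixes P e f d :: real and l A B :: complex
  assumes "P \<noteq> 0" "l \<notin> \<real>"
  shows "\<exists>!x. of_real P * fst x + of_real e * snd x = A \<and>
              of_real f * fst x + B + of_real d * snd x = l * snd x"
proof -
  define k where "k = l - of_real d"
  define D where "D = of_real P * k + of_real e * of_real f"
  have "Im D = P * Im l" by (simp add: D_def k_def)
  with assms have D: "D \<noteq> 0" by (auto simp: complex_is_Real_iff)
  have unique: "D * fst x = k * A - of_real e * B \<and> D * snd x = of_real P * B + of_real f * A"
    if "of_real P * fst x + of_real e * snd x = A \<and>
        of_real f * fst x + B + of_real d * snd x = l * snd x" for x :: "complex \<times> complex"
  proof -
    have A: "A = of_real P * fst x + of_real e * snd x"
      and B: "B = k * snd x - of_real f * fst x"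
      using that by (auto simp: k_def algebra_simps)
    show ?thesis unfolding D_def A B by (simp add: algebra_simps)
  qed
  show ?thesis
  proof (rule ex1I)
    let ?x = "((k * A - of_real e * B) / D, (of_real P * B + of_real f * A) / D)"
    have x1: "D * fst ?x = k * A - of_real e * B" and x2: "D * snd ?x = of_real P * B + of_real f * A"
      using D by simp_all
    have "D * (of_real P * fst ?x + of_real e * snd ?x) =
        of_real P * (D * fst ?x) + of_real e * (D * snd ?x)"
      by (simp only: algebra_simps)
    also have "\<dots> = D * A"
      unfolding x1 x2 by (simp add: D_def algebra_simps)
    finally have "D * (of_real P * fst ?x + of_real e * snd ?x) = D * A" .
    moreover have "D * (k * snd ?x - of_real f * fst ?x) = D * B"
    proof -
      have "D * (k * snd ?x - of_real f * fst ?x) = k * (D * snd ?x) - of_real f * (D * fst ?x)"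
        by (simp only: algebra_simps)
      also have "\<dots> = D * B"
        unfolding x1 x2 by (simp add: D_def algebra_simps)
      finally show ?thesis .
    qed
    ultimately have "of_real P * fst ?x + of_real e * snd ?x = A"
      and "k * snd ?x - of_real f * fst ?x = B"
      using D by (metis mult_left_cancel)+
    then show "of_real P * fst ?x + of_real e * snd ?x = A \<and>
        of_real f * fst ?x + B + of_real d * snd ?x = l * snd ?x"
      unfolding k_def by (metis add.commute diff_add_cancel left_diff_distrib diff_eq_eq)
  next
    fix x :: "complex \<times> complex"
    assume "of_real P * fst x + of_real e * snd x = A \<and>
        of_real f * fst x + B + of_real d * snd x = l * snd x"
    then have "D * fst x = k * A - of_real e * B \<and> D * snd x = of_real P * B + of_real f * A"
      by (rule unique)
    with D show "x = ((k * A - of_real e * B) / D, (of_real P * B + of_real f * A) / D)"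
      by (simp add: prod_eq_iff eq_divide_eq mult.commute)
  qed
qed

lemma ivp_solution_ex1:
  assumes p: "\<forall>t\<ge>a - 1. p t \<noteq> 0" and l: "\<mu> \<notin> \<real>"
  shows "\<exists>!y. is_solution a p q c h d \<mu> y \<and> fst (y a) = u \<and> quasi_diff p c y (a - 1) = v \<and>
              (\<forall>t<a - 1. y t = (0, 0))"
proof -
  define step where "step t u v x \<longleftrightarrow>
      complex_of_real (p t) * fst x + of_real (c t - h t) * snd x = v + (of_real (q t) - \<mu>) * u \<and>
      of_real (c t) * fst x + of_real (h t) * u + of_real (d t) * snd x = \<mu> * snd x" for t u v x
  define step0 where "step0 x \<longleftrightarrow>
      complex_of_real (p (a - 1)) * fst x + of_real (c (a - 1)) * snd x = v \<and>
      of_real (c (a - 1) - h (a - 1)) * fst x + of_real (h (a - 1)) * u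
        + of_real (d (a - 1)) * snd x = \<mu> * snd x" for x
  have step_ex1: "\<exists>!x. step t u v x" if "t \<ge> a" for t u v
    unfolding step_def using p l that by (intro linear_system_ex1) auto
  have step0: "\<exists>!x. step0 x"
    unfolding step0_def using p l by (intro linear_system_ex1) auto
  define delta :: "(int \<Rightarrow> complex \<times> complex) \<Rightarrow> int \<Rightarrow> complex \<times> complex"
    where "delta y t = (fst (y (t + 1)) - fst (y t), snd (y t))" for y t
  have char: "is_solution a p q c h d \<mu> y \<and> fst (y a) = u \<and> quasi_diff p c y (a - 1) = v \<longleftrightarrow>
      fst (y a) = u \<and> step0 (delta y (a - 1)) \<and>
      (\<forall>t\<ge>a. step t (fst (y t)) (quasi_diff p c y (t - 1)) (delta y t))" for y
  proof -
    have split: "(\<forall>t\<ge>a - 1. Q t) \<longleftrightarrow> Q (a - 1) \<and> (\<forall>t\<ge>a. Q t)" for Q :: "int \<Rightarrow> bool"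
    proof -
      have "t \<ge> a - 1 \<longleftrightarrow> t = a - 1 \<or> t \<ge> a" for t by auto
      then show ?thesis by auto
    qed
    show ?thesis
      unfolding is_solution_def split step_def step0_def delta_def quasi_diff_def bdiff_def fdiff_def
      by (auto simp: algebra_simps)
  qed
  show ?thesis
  proof (rule ex_ex1I)
    define S where "S = rec_nat (u, v) (\<lambda>n (u, v).
      let t = a + int n; x = (THE x. step t u v x)
      in (u + fst x, complex_of_real (p t) * fst x + of_real (c t) * snd x))"
    define X where "X n = (THE x. step (a + int n) (fst (S n)) (snd (S n)) x)" for n
    have S0: "S 0 = (u, v)" by (simp add: S_def)
    have S_Suc: "S (Suc n) = (fst (S n) + fst (X n),
        complex_of_real (p (a + int n)) * fst (X n) + of_real (c (a + int n)) * snd (X n))" for n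
      by (simp add: S_def X_def Let_def case_prod_beta)
    have X: "step (a + int n) (fst (S n)) (snd (S n)) (X n)" for n
      unfolding X_def by (rule theI') (use step_ex1 in auto)
    obtain x0 where x0: "step0 x0" using step0 by blast
    define y where "y t = (if t < a - 1 then (0, 0) else if t = a - 1 then (u - fst x0, snd x0)
      else (fst (S (nat (t - a))), snd (X (nat (t - a)))))" for t
    have y_n: "y (a + int n) = (fst (S n), snd (X n))" for n by (simp add: y_def)
    have delta_n: "delta y (a + int n) = X n" for n
      using y_n[of n] y_n[of "Suc n"]
      by (simp add: delta_def S_Suc add.assoc add.commute[of 1] prod_eq_iff)
    have ya: "fst (y a) = u" using y_n[of 0] by (simp add: S0)
    have delta0: "delta y (a - 1) = x0" using ya by (simp add: delta_def prod_eq_iff y_def)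
    have qd: "quasi_diff p c y t =
        complex_of_real (p t) * fst (delta y t) + of_real (c t) * snd (delta y t)" for t
      by (simp add: quasi_diff_def delta_def fdiff_def)
    have qd_n: "quasi_diff p c y (a + int n - 1) = snd (S n)" for n
    proof (cases n)
      case 0
      then show ?thesis using x0 by (simp add: qd delta0 S0 step0_def)
    next
      case (Suc m)
      then show ?thesis using qd[of "a + int m"] by (simp add: delta_n S_Suc)
    qed
    have "step t (fst (y t)) (quasi_diff p c y (t - 1)) (delta y t)" if "t \<ge> a" for t
    proof -
      have t: "t = a + int (nat (t - a))" using that by simp
      show ?thesis by (subst (1 2 3 4) t) (simp only: y_n delta_n qd_n fst_conv X)
    qed
    with ya x0 delta0
    show "\<exists>y. is_solution a p q c h d \<mu> y \<and> fst (y a) = u \<and> quasi_diff p c y (a - 1) = v \<and>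
        (\<forall>t<a - 1. y t = (0, 0))"
      by (intro exI[of _ y]) (use char[of y] in \<open>auto simp: y_def\<close>)
  next
    fix y y'
    assume y: "is_solution a p q c h d \<mu> y \<and> fst (y a) = u \<and> quasi_diff p c y (a - 1) = v \<and>
        (\<forall>t<a - 1. y t = (0, 0))"
      and y': "is_solution a p q c h d \<mu> y' \<and> fst (y' a) = u \<and> quasi_diff p c y' (a - 1) = v \<and>
        (\<forall>t<a - 1. y' t = (0, 0))"
    have qd: "quasi_diff p c y t =
        complex_of_real (p t) * fst (delta y t) + of_real (c t) * snd (delta y t)" for t y
      by (simp add: quasi_diff_def delta_def fdiff_def)
    have ch: "step0 (delta y (a - 1))" "step0 (delta y' (a - 1))"
        "\<And>t. t \<ge> a \<Longrightarrow> step t (fst (y t)) (quasi_diff p c y (t - 1)) (delta y t)"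
        "\<And>t. t \<ge> a \<Longrightarrow> step t (fst (y' t)) (quasi_diff p c y' (t - 1)) (delta y' t)"
      using char[of y] char[of y'] y y' by blast+
    have eq0: "delta y (a - 1) = delta y' (a - 1)" using step0 ch(1,2) by blast
    have main: "fst (y t) = fst (y' t) \<and> quasi_diff p c y (t - 1) = quasi_diff p c y' (t - 1) \<and>
        delta y t = delta y' t" if "t \<ge> a" for t
      using that
    proof (induction t rule: int_ge_induct)
      case base
      then show ?case using step_ex1[of a] ch(3)[of a] ch(4)[of a] y y' by auto
    next
      case (step t)
      have 1: "fst (y (t + 1)) = fst (y' (t + 1))"
        using step.IH by (auto simp: delta_def)
      have 2: "quasi_diff p c y (t + 1 - 1) = quasi_diff p c y' (t + 1 - 1)"
        using step.IH by (simp add: qd)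
      have "step (t + 1) (fst (y (t + 1))) (quasi_diff p c y (t + 1 - 1)) (delta y (t + 1))"
        "step (t + 1) (fst (y (t + 1))) (quasi_diff p c y (t + 1 - 1)) (delta y' (t + 1))"
        using ch(3)[of "t + 1"] ch(4)[of "t + 1"] step.hyps 1 2 by simp_all
      with step_ex1[of "t + 1"] step.hyps
      have "delta y (t + 1) = delta y' (t + 1)" by (metis add_increasing2 zero_le_one)
      with 1 2 show ?case by blast
    qed
    show "y = y'"
    proof
      fix t
      consider "t < a - 1" | "t = a - 1" | "t \<ge> a" by linarith
      then show "y t = y' t"
      proof cases
        case 1
        then show ?thesis using y y' by simp
      next
        case 2
        then show ?thesis using eq0 y y' by (simp add: delta_def prod_eq_iff)
      next
        case 3
        then show ?thesis using main[OF 3] by (simp add: delta_def prod_eq_iff)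
      qed
    qed
  qed
qed

end

theory Submission
  imports Defs
begin

text \<open>
  Everything is read off from the solution \<open>\<chi> = \<phi> + m \<psi>\<close> belonging to a point \<open>m\<close> of the plane.
  A real boundary condition \<open>U\<^sub>2(\<chi>) = 0\<close> at \<open>N\<close> holds for some \<open>\<beta>\<close> exactly if \<open>\<chi>\<^sub>1(N + 1)\<close> and
  \<open>\<chi>\<^sup>[\<^sup>1\<^sup>](N)\<close> are linearly dependent over the reals, that is, if the imaginary part of
  \<open>cnj (\<chi>\<^sub>1(N + 1)) * \<chi>\<^sup>[\<^sup>1\<^sup>](N)\<close> vanishes. By Green's formula (\<open>green_formula\<close>) this imaginary part is
  \<open>Im m - Im \<mu> * (\<Sum>t=a..N. \<bar>\<chi>(t)\<bar>\<^sup>2)\<close>. As a function of \<open>m\<close> it is a real quadratic polynomial with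
  leading part a multiple of \<open>\<bar>m\<bar>\<^sup>2\<close>, so \<open>C\<^sub>N\<close> is indeed a circle, and its closed disc consists of the
  \<open>m\<close> with \<open>(\<Sum>t=a..N. \<bar>\<chi>(t)\<bar>\<^sup>2) \<le> Im m / Im \<mu>\<close> (\<open>weyl_disc\<close>). These compact discs shrink as \<open>N\<close>
  grows, hence have a common point.

  If they had two common points, the corresponding solutions would both be square summable, and
  so would their difference, a nonzero multiple of \<open>\<psi>\<close>. But the Wronskian of \<open>\<chi>\<close> and \<open>\<psi>\<close> is
  constantly \<open>1\<close> (\<open>wronskian_const\<close>). Divided by \<open>p(t)\<close>, this identity expresses \<open>1 / p(t)\<close> through
  products of values of \<open>\<chi>\<close> and \<open>\<psi>\<close> at \<open>t\<close> and \<open>t + 1\<close> with the coefficients \<open>1\<close> and \<open>c(t) / p(t)\<close>,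
  which are bounded. So \<open>1 / \<bar>p\<bar>\<close> would be summable, contrary to the hypothesis
  (\<open>no_square_summable_pair\<close>).
\<close>

section \<open>Circles as zero sets of a Hermitian form\<close>

text \<open>
  The content is that a circle determines its disc: the disc is the convex hull of the circle.
\<close>

lemma bounded_disc_sphere:
  assumes "r > 0"
  shows "bounded_disc (sphere z r) = cball z r"
proof -
  have hull: "cball w s = convex hull (sphere w s)" for w :: complex and s
    using Krein_Milman_frontier[of "cball w s"] by simp
  have "cball w s = cball z r" if "sphere w s = sphere z r" for w s
    using that hull[of w s] hull[of z r] by simp
  then show ?thesis
    unfolding bounded_disc_def using assms by blast
qed

text \<open>
  As \<open>\<beta>\<close> runs over \<open>[0, \<pi>)\<close>, the vector \<open>(cos \<beta>, sin \<beta>)\<close> represents every real line through the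
  origin once; so the existence of \<open>\<beta>\<close> is real linear dependence of \<open>u\<close> and \<open>v\<close>.
\<close>

lemma real_boundary_condition_iff:
  fixes u v :: complex
  shows "(\<exists>\<beta>. 0 \<le> \<beta> \<and> \<beta> < pi \<and>
           u * complex_of_real (cos \<beta>) + v * complex_of_real (sin \<beta>) = 0) \<longleftrightarrow> Im (cnj u * v) = 0"
    (is "?L \<longleftrightarrow> ?R")
proof
  assume ?L
  then obtain \<beta> where b: "u * complex_of_real (cos \<beta>) + v * complex_of_real (sin \<beta>) = 0" by blast
  have re: "Re u * cos \<beta> + Re v * sin \<beta> = 0" and im: "Im u * cos \<beta> + Im v * sin \<beta> = 0"
    using arg_cong[OF b, of Re] arg_cong[OF b, of Im] by simp_all
  \<comment> \<open>The imaginary part is the determinant of \<open>u\<close> and \<open>v\<close> as vectors in the real plane; the two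
    identities are Cramer's rule for the dependence \<open>(cos \<beta>, sin \<beta>)\<close>.\<close>
  have "cos \<beta> * Im (cnj u * v) = (Re u * cos \<beta> + Re v * sin \<beta>) * Im v
      - (Im u * cos \<beta> + Im v * sin \<beta>) * Re v"
    by (simp add: algebra_simps)
  moreover have "sin \<beta> * Im (cnj u * v) = Re u * (Im u * cos \<beta> + Im v * sin \<beta>)
      - Im u * (Re u * cos \<beta> + Re v * sin \<beta>)"
    by (simp add: algebra_simps)
  ultimately have "cos \<beta> * Im (cnj u * v) = 0" "sin \<beta> * Im (cnj u * v) = 0"
    using re im by simp_all
  then show ?R
    using sin_cos_squared_add[of \<beta>] by (metis add_0 mult_eq_0_iff power_zero_numeral zero_neq_one)
next
  assume R: ?R
  show ?L
  proof (cases "u = 0")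
    case True
    then show ?thesis by (intro exI[of _ 0]) simp
  next
    case False
    have "Im (v / u) = 0"
      using R by (simp add: Im_divide algebra_simps)
    then obtain s where s: "v / u = complex_of_real s"
      by (metis complex_is_Real_iff Reals_cases)
    then have v: "v = complex_of_real s * u" using False by (simp add: field_simps)
    \<comment> \<open>The equation \<open>cos \<beta> + s sin \<beta> = 0\<close> is solved by \<open>\<beta> = arctan s + \<pi> / 2\<close>.\<close>
    have "sin (arctan s) = s * cos (arctan s)"
      using tan_arctan[of s] cos_arctan_not_zero[of s] by (simp add: tan_def field_simps)
    then have "complex_of_real (cos (arctan s + pi / 2))
        + complex_of_real s * complex_of_real (sin (arctan s + pi / 2)) = 0"
      by (simp add: cos_add sin_add flip: of_real_mult)
    then have "u * complex_of_real (cos (arctan s + pi / 2))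
        + v * complex_of_real (sin (arctan s + pi / 2)) = 0"
      unfolding v by (metis (no_types, lifting) distrib_left mult.assoc mult.commute mult_zero_right)
    then show ?thesis
      using arctan_bounded[of s] by (intro exI[of _ "arctan s + pi / 2"]) auto
  qed
qed

text \<open>
  The fraction is the value of \<open>m\<close> for which \<open>A + m C\<close> and \<open>B + m D\<close> satisfy the boundary condition
  with parameter \<open>\<beta>\<close>. The hypothesis says that \<open>C\<close> and \<open>D\<close> satisfy none of these conditions, so
  no denominator vanishes.
\<close>

lemma moebius_image_real_line:
  fixes A B C D :: complex
  assumes k: "Im (cnj C * D) \<noteq> 0"
  shows "{- (A * complex_of_real (cos \<beta>) + B * complex_of_real (sin \<beta>)) /
            (C * complex_of_real (cos \<beta>) + D * complex_of_real (sin \<beta>)) | \<beta>. 0 \<le> \<beta> \<and> \<beta> < pi} =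
         {m. Im (cnj (A + m * C) * (B + m * D)) = 0}"
proof -
  have nz: "C * complex_of_real (cos \<beta>) + D * complex_of_real (sin \<beta>) \<noteq> 0"
    if "0 \<le> \<beta>" "\<beta> < pi" for \<beta>
    using k real_boundary_condition_iff[of C D] that by blast
  have "m = - (A * complex_of_real (cos \<beta>) + B * complex_of_real (sin \<beta>)) /
            (C * complex_of_real (cos \<beta>) + D * complex_of_real (sin \<beta>)) \<longleftrightarrow>
        (A + m * C) * complex_of_real (cos \<beta>) + (B + m * D) * complex_of_real (sin \<beta>) = 0"
    if "0 \<le> \<beta>" "\<beta> < pi" for \<beta> m
  proof -
    have "m = - (A * complex_of_real (cos \<beta>) + B * complex_of_real (sin \<beta>)) /
            (C * complex_of_real (cos \<beta>) + D * complex_of_real (sin \<beta>)) \<longleftrightarrow>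
        m * (C * complex_of_real (cos \<beta>) + D * complex_of_real (sin \<beta>)) =
        - (A * complex_of_real (cos \<beta>) + B * complex_of_real (sin \<beta>))"
      using nz[OF that] by (rule nonzero_eq_divide_eq)
    also have "\<dots> \<longleftrightarrow> m * (C * complex_of_real (cos \<beta>) + D * complex_of_real (sin \<beta>)) +
        (A * complex_of_real (cos \<beta>) + B * complex_of_real (sin \<beta>)) = 0"
      by (rule eq_neg_iff_add_eq_0)
    also have "m * (C * complex_of_real (cos \<beta>) + D * complex_of_real (sin \<beta>)) +
        (A * complex_of_real (cos \<beta>) + B * complex_of_real (sin \<beta>)) =
        (A + m * C) * complex_of_real (cos \<beta>) + (B + m * D) * complex_of_real (sin \<beta>)"
      by (simp add: algebra_simps)
    finally show ?thesis .
  qed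
  then show ?thesis
    unfolding real_boundary_condition_iff[symmetric] by blast
qed

text \<open>
  With \<open>k = Im (cnj C * D)\<close>, the left-hand side is \<open>k \<bar>m\<bar>\<^sup>2 + Im (m E) + Im (cnj A * B)\<close> for
  \<open>E = cnj A * D - C * cnj B\<close>. Completing the square gives the centre, and the discriminant
  \<open>\<bar>E\<bar>\<^sup>2 - 4 k Im (cnj A * B)\<close> is \<open>\<bar>A D - B C\<bar>\<^sup>2\<close>; in the application this determinant is the Wronskian.
\<close>

lemma hermitian_form_complete_square:
  fixes A B C D m :: complex
  defines "k \<equiv> Im (cnj C * D)"
  defines "z \<equiv> - \<i> * cnj (cnj A * D - C * cnj B) / (2 * complex_of_real k)"
  assumes k: "k \<noteq> 0"
  shows "Im (cnj (A + m * C) * (B + m * D)) =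
           k * ((cmod (m - z))\<^sup>2 - (cmod (A * D - B * C) / (2 * k))\<^sup>2)"
proof -
  define E where "E = cnj A * D - C * cnj B"
  have E: "(cmod E)\<^sup>2 - 4 * k * Im (cnj A * B) = (cmod (A * D - B * C))\<^sup>2"
    unfolding E_def k_def cmod_power2 by (simp add: power2_eq_square) algebra
  have Re_z: "Re z = - Im E / (2 * k)" and Im_z: "Im z = - Re E / (2 * k)"
    unfolding z_def E_def[symmetric] using k by (simp_all add: Re_divide Im_divide power2_eq_square)
  have "k * ((cmod (m - z))\<^sup>2 - (cmod (A * D - B * C) / (2 * k))\<^sup>2) =
      k * (cmod m)\<^sup>2 + Re m * Im E + Im m * Re E + Im (cnj A * B)"
    unfolding power_divide E[symmetric]
    unfolding cmod_power2 minus_complex.simps Re_z Im_z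
    using k by (simp add: power2_eq_square field_simps)
  also have "\<dots> = Im (cnj (A + m * C) * (B + m * D))"
    unfolding E_def k_def cmod_power2 by (simp add: power2_eq_square algebra_simps)
  finally show ?thesis by simp
qed

text \<open>
  Division by the leading coefficient \<open>Im (cnj C * D)\<close> fixes the sign: the quotient is negative
  inside the circle and positive outside.
\<close>

lemma bounded_disc_hermitian_form:
  fixes A B C D :: complex
  assumes k: "Im (cnj C * D) \<noteq> 0" and W: "A * D - B * C \<noteq> 0"
  defines "F \<equiv> \<lambda>m. Im (cnj (A + m * C) * (B + m * D)) / Im (cnj C * D)"
  shows "bounded_disc {m. Im (cnj (A + m * C) * (B + m * D)) = 0} = {m. F m \<le> 0}"
    and "compact {m. F m \<le> 0}" and "{m. F m \<le> 0} \<noteq> {}"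
proof -
  define k where "k = Im (cnj C * D)"
  define z where "z = - \<i> * cnj (cnj A * D - C * cnj B) / (2 * complex_of_real k)"
  define r where "r = cmod (A * D - B * C) / \<bar>2 * k\<bar>"
  have k0: "k \<noteq> 0" using k by (simp add: k_def)
  have r: "r > 0" using W k0 by (simp add: r_def)
  have F: "F m = (cmod (m - z))\<^sup>2 - r\<^sup>2" for m
    using hermitian_form_complete_square[OF k, of A m B] k0
    unfolding F_def r_def z_def k_def by (simp add: power_divide)
  have "Im (cnj (A + m * C) * (B + m * D)) = 0 \<longleftrightarrow> F m = 0" for m
    using k by (simp add: F_def)
  moreover have "F m = 0 \<longleftrightarrow> m \<in> sphere z r" for m
    using r by (simp add: F dist_norm norm_minus_commute power2_eq_iff_nonneg)
  ultimately have "{m. Im (cnj (A + m * C) * (B + m * D)) = 0} = sphere z r" by blast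
  moreover have "F m \<le> 0 \<longleftrightarrow> m \<in> cball z r" for m
    using r by (simp add: F dist_norm norm_minus_commute power_mono_iff)
  then have disc: "{m. F m \<le> 0} = cball z r" by blast
  ultimately show "bounded_disc {m. Im (cnj (A + m * C) * (B + m * D)) = 0} = {m. F m \<le> 0}"
    using bounded_disc_sphere[OF r] by simp
  show "compact {m. F m \<le> 0}" "{m. F m \<le> 0} \<noteq> {}"
    using disc r by simp_all
qed

section \<open>Green's formula and the Wronskian\<close>

definition lin_comb ::
  "(int \<Rightarrow> complex \<times> complex) \<Rightarrow> complex \<Rightarrow> (int \<Rightarrow> complex \<times> complex) \<Rightarrow> int \<Rightarrow> complex \<times> complex"
  where "lin_comb y m z t = (fst (y t) + m * fst (z t), snd (y t) + m * snd (z t))"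

lemma quasi_diff_lin_comb:
  "quasi_diff p c (lin_comb y m z) t = quasi_diff p c y t + m * quasi_diff p c z t"
  by (simp add: quasi_diff_def fdiff_def lin_comb_def algebra_simps)

definition wronskian where
  "wronskian p c y z t = fst (y (t + 1)) * quasi_diff p c z t - quasi_diff p c y t * fst (z (t + 1))"

context
  fixes a :: int and p q c h d :: "int \<Rightarrow> real" and \<mu> :: complex
begin

abbreviation "sol \<equiv> is_solution a p q c h d \<mu>"

text \<open>
  The system in the form of a first-order recursion for the quasi-difference together with an
  algebraic constraint.
\<close>

lemma is_solution_iff:
  "sol y \<longleftrightarrow>
    (\<forall>t\<ge>a. quasi_diff p c y t = quasi_diff p c y (t - 1)
              + (complex_of_real (q t) - \<mu>) * fst (y t) + complex_of_real (h t) * snd (y t)) \<and>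
    (\<forall>t\<ge>a - 1. complex_of_real (c t) * fdiff (\<lambda>r. fst (y r)) t + complex_of_real (h t) * fst (y t)
              = (\<mu> - complex_of_real (d t)) * snd (y t))"
proof -
  have 1: "- (P - P') + Q * u - (R - R') + H * v = \<mu> * u \<longleftrightarrow>
      P + R = P' + R' + (Q - \<mu>) * u + H * v" for P P' Q u R R' H v :: complex
  proof -
    have "(- (P - P') + Q * u - (R - R') + H * v) - \<mu> * u =
        (P' + R' + (Q - \<mu>) * u + H * v) - (P + R)" by (simp add: algebra_simps)
    then show ?thesis by (metis eq_iff_diff_eq_0)
  qed
  have 2: "x + y + D * v = \<mu> * v \<longleftrightarrow> x + y = (\<mu> - D) * v" for x y D v :: complex
    by (metis eq_diff_eq left_diff_distrib)
  show ?thesis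
    unfolding is_solution_def quasi_diff_def bdiff_def 1 2 ..
qed

lemma is_solution_lin_comb:
  assumes "sol y" "sol z"
  shows "sol (lin_comb y m z)"
proof -
  have eq1: "quasi_diff p c w t = quasi_diff p c w (t - 1)
      + (complex_of_real (q t) - \<mu>) * fst (w t) + complex_of_real (h t) * snd (w t)"
    if "t \<ge> a" "sol w" for w t
    using that unfolding is_solution_iff by blast
  have eq2: "complex_of_real (c t) * fdiff (\<lambda>r. fst (w r)) t + complex_of_real (h t) * fst (w t)
      = (\<mu> - complex_of_real (d t)) * snd (w t)"
    if "t \<ge> a - 1" "sol w" for w t
    using that unfolding is_solution_iff by blast
  show ?thesis
    unfolding is_solution_iff quasi_diff_lin_comb
  proof (intro conjI allI impI)
    fix t assume t: "t \<ge> a"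
    show "quasi_diff p c y t + m * quasi_diff p c z t =
        quasi_diff p c y (t - 1) + m * quasi_diff p c z (t - 1)
        + (complex_of_real (q t) - \<mu>) * fst (lin_comb y m z t)
        + complex_of_real (h t) * snd (lin_comb y m z t)"
      unfolding eq1[OF t assms(1)] eq1[OF t assms(2)]
      by (simp add: lin_comb_def algebra_simps)
  next
    fix t assume t: "t \<ge> a - 1"
    have "complex_of_real (c t) * fdiff (\<lambda>r. fst (lin_comb y m z r)) t
        + complex_of_real (h t) * fst (lin_comb y m z t) =
        (complex_of_real (c t) * fdiff (\<lambda>r. fst (y r)) t + complex_of_real (h t) * fst (y t))
        + m * (complex_of_real (c t) * fdiff (\<lambda>r. fst (z r)) t + complex_of_real (h t) * fst (z t))"
      by (simp add: fdiff_def lin_comb_def algebra_simps)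
    also have "\<dots> = (\<mu> - complex_of_real (d t)) * snd (lin_comb y m z t)"
      unfolding eq2[OF t assms(1)] eq2[OF t assms(2)]
      by (simp add: lin_comb_def algebra_simps)
    finally show "complex_of_real (c t) * fdiff (\<lambda>r. fst (lin_comb y m z r)) t
        + complex_of_real (h t) * fst (lin_comb y m z t)
        = (\<mu> - complex_of_real (d t)) * snd (lin_comb y m z t)" .
  qed
qed

text \<open>
  In passing from \<open>t - 1\<close> to \<open>t\<close> the terms with \<open>p\<close> and \<open>q - \<mu>\<close> cancel by symmetry. What remains are
  the terms with \<open>c\<close> and \<open>h\<close>, in which the algebraic constraint replaces \<open>c \<Delta>y\<^sub>1 + h y\<^sub>1\<close> by
  \<open>(\<mu> - d) y\<^sub>2\<close>; then they cancel by symmetry too.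
\<close>

lemma wronskian_const:
  assumes y: "sol y" and z: "sol z" and t: "t \<ge> a - 1"
  shows "wronskian p c y z t = wronskian p c y z (a - 1)"
  using t
proof (induction t rule: int_ge_induct)
  case base
  then show ?case by simp
next
  case (step s)
  define t where "t = s + 1"
  have t: "t \<ge> a" using step.hyps by (simp add: t_def)
  define u x v U X V where defs:
    "u = fst (y t)" "x = fdiff (\<lambda>r. fst (y r)) t" "v = snd (y t)"
    "U = fst (z t)" "X = fdiff (\<lambda>r. fst (z r)) t" "V = snd (z t)"
  have next_vals: "fst (y (t + 1)) = u + x" "fst (z (t + 1)) = U + X" by (simp_all add: defs fdiff_def)
  have Y: "quasi_diff p c y t = quasi_diff p c y s + (complex_of_real (q t) - \<mu>) * u + complex_of_real (h t) * v"
    "quasi_diff p c z t = quasi_diff p c z s + (complex_of_real (q t) - \<mu>) * U + complex_of_real (h t) * V"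
    using y z t unfolding is_solution_iff by (simp_all add: defs t_def)
  have Y': "quasi_diff p c y t = complex_of_real (p t) * x + complex_of_real (c t) * v"
    "quasi_diff p c z t = complex_of_real (p t) * X + complex_of_real (c t) * V"
    by (simp_all add: quasi_diff_def defs)
  have alg: "complex_of_real (c t) * x + complex_of_real (h t) * u = (\<mu> - complex_of_real (d t)) * v"
    "complex_of_real (c t) * X + complex_of_real (h t) * U = (\<mu> - complex_of_real (d t)) * V"
    using y z t unfolding is_solution_iff by (simp_all add: defs)
  have "wronskian p c y z t = u * quasi_diff p c z t - quasi_diff p c y t * U
      + (x * quasi_diff p c z t - quasi_diff p c y t * X)"
    unfolding wronskian_def next_vals by (simp add: algebra_simps)
  also have "x * quasi_diff p c z t - quasi_diff p c y t * X = complex_of_real (c t) * (x * V - X * v)"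
    unfolding Y' by (simp add: algebra_simps)
  also have "u * quasi_diff p c z t - quasi_diff p c y t * U =
      u * quasi_diff p c z s - quasi_diff p c y s * U + complex_of_real (h t) * (u * V - v * U)"
    unfolding Y by (simp add: algebra_simps)
  also have "\<dots> + complex_of_real (c t) * (x * V - X * v) = u * quasi_diff p c z s - quasi_diff p c y s * U
      + (complex_of_real (c t) * x + complex_of_real (h t) * u) * V
      - (complex_of_real (c t) * X + complex_of_real (h t) * U) * v"
    by (simp add: algebra_simps)
  also have "\<dots> = wronskian p c y z s"
    unfolding alg by (simp add: wronskian_def defs t_def)
  finally show ?case using step.IH by (simp add: t_def)
qed

text \<open>
  The same computation with \<open>cnj y\<close> in place of the second solution. The coefficients are real, so
  only \<open>\<mu>\<close> contributes to the imaginary part: once with \<open>\<bar>y\<^sub>1\<bar>\<^sup>2\<close> from the recursion and once with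
  \<open>\<bar>y\<^sub>2\<bar>\<^sup>2\<close> from the algebraic constraint.
\<close>

lemma green_formula:
  assumes y: "sol y" and t: "t \<ge> a - 1"
  shows "Im (cnj (fst (y (t + 1))) * quasi_diff p c y t) =
         Im (cnj (fst (y a)) * quasi_diff p c y (a - 1)) - Im \<mu> * (\<Sum>s=a..t. (norm (y s))\<^sup>2)"
  using t
proof (induction t rule: int_ge_induct)
  case base
  then show ?case by simp
next
  case (step s)
  define t where "t = s + 1"
  have t: "t \<ge> a" using step.hyps by (simp add: t_def)
  define u x v Y where defs:
    "u = fst (y t)" "x = fdiff (\<lambda>r. fst (y r)) t" "v = snd (y t)" "Y = quasi_diff p c y s"
  have next_val: "fst (y (t + 1)) = u + x" by (simp add: defs fdiff_def)
  have Y: "quasi_diff p c y t = Y + (complex_of_real (q t) - \<mu>) * u + complex_of_real (h t) * v"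
    using y t unfolding is_solution_iff by (simp add: defs t_def)
  have Y': "quasi_diff p c y t = complex_of_real (p t) * x + complex_of_real (c t) * v"
    by (simp add: quasi_diff_def defs)
  have alg: "complex_of_real (c t) * x + complex_of_real (h t) * u = (\<mu> - complex_of_real (d t)) * v"
    using y t unfolding is_solution_iff by (simp add: defs)
  have "cnj (fst (y (t + 1))) * quasi_diff p c y t
      = cnj u * quasi_diff p c y t + cnj x * quasi_diff p c y t"
    unfolding next_val by (simp add: algebra_simps)
  also have "\<dots> = cnj u * Y + (complex_of_real (q t) - \<mu>) * (u * cnj u) + complex_of_real (p t) * (x * cnj x)
      + cnj (complex_of_real (c t) * x + complex_of_real (h t) * u) * v"
    by (subst Y, subst Y') (simp add: algebra_simps)
  also have "\<dots> = cnj u * Y + (complex_of_real (q t) - \<mu>) * complex_of_real ((cmod u)\<^sup>2)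
      + complex_of_real (p t) * complex_of_real ((cmod x)\<^sup>2)
      + (cnj \<mu> - complex_of_real (d t)) * complex_of_real ((cmod v)\<^sup>2)"
    unfolding alg complex_norm_square by (simp add: mult_ac)
  finally have eq: "cnj (fst (y (t + 1))) * quasi_diff p c y t = \<dots>" .
  have "Im (cnj (fst (y (t + 1))) * quasi_diff p c y t) =
      Im (cnj u * Y) - Im \<mu> * ((cmod u)\<^sup>2 + (cmod v)\<^sup>2)"
    unfolding eq by (simp only: plus_complex.simps minus_complex.simps times_complex.simps
      Re_complex_of_real Im_complex_of_real complex_cnj) (simp add: algebra_simps)
  also have "(cmod u)\<^sup>2 + (cmod v)\<^sup>2 = (norm (y t))\<^sup>2"
    by (simp add: norm_prod_def defs)
  finally have "Im (cnj (fst (y (t + 1))) * quasi_diff p c y t) = Im (cnj u * Y) - Im \<mu> * (norm (y t))\<^sup>2" .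
  moreover have "{a..t} = insert t {a..s}" using t by (auto simp: t_def)
  then have "(\<Sum>r=a..t. (norm (y r))\<^sup>2) = (norm (y t))\<^sup>2 + (\<Sum>r=a..s. (norm (y r))\<^sup>2)"
    by (simp add: t_def)
  ultimately show ?case
    using step.IH by (simp add: defs t_def algebra_simps)
qed

section \<open>Square-summable solutions\<close>

text \<open>
  Divided by \<open>p(t)\<close>, the Wronskian identity reads
  \<open>1 / p(t) = y\<^sub>1(t+1) (\<Delta>z\<^sub>1(t) + (c/p) z\<^sub>2(t)) - (\<Delta>y\<^sub>1(t) + (c/p) y\<^sub>2(t)) z\<^sub>1(t+1)\<close>. For bounded \<open>c / p\<close> the
  inequality between the arithmetic and the geometric mean bounds the right-hand side by a
  multiple of \<open>\<bar>y\<bar>\<^sup>2 + \<bar>z\<bar>\<^sup>2\<close>, summed over the two places \<open>t\<close> and \<open>t + 1\<close>.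
\<close>

lemma no_square_summable_pair:
  fixes N :: int and K B :: real
  assumes p: "\<forall>t\<ge>a - 1. p t \<noteq> 0" and N: "N \<ge> a"
    and bound: "\<forall>t>N. \<bar>c t / p t\<bar> \<le> K"
    and divergent: "filterlim (\<lambda>M. \<Sum>t=N..M. 1 / \<bar>p t\<bar>) at_top at_top"
    and y: "sol y" and z: "sol z" and W: "wronskian p c y z (a - 1) = 1"
    and y_le: "\<And>M. (\<Sum>t=a..M. (norm (y t))\<^sup>2) \<le> B" and z_le: "\<And>M. (\<Sum>t=a..M. (norm (z t))\<^sup>2) \<le> B"
  shows False
proof -
  define g where "g t = (norm (y t))\<^sup>2 + (norm (z t))\<^sup>2" for t
  have g0: "g t \<ge> 0" for t by (simp add: g_def)
  have g_le: "(\<Sum>t=a..M. g t) \<le> 2 * B" for M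
    using y_le[of M] z_le[of M] by (simp add: g_def sum.distrib)
  have K: "K \<ge> 0" by (rule order_trans[OF abs_ge_zero bound[rule_format, of "N + 1"]]) simp
  have term_le: "1 / \<bar>p t\<bar> \<le> (2 + K) * (g t + g (t + 1))" if t: "t > N" for t
  proof -
    define A A' B B' where defs: "A = norm (y t)" "A' = norm (y (t + 1))"
      "B = norm (z t)" "B' = norm (z (t + 1))"
    have pt: "p t \<noteq> 0" using p N t by auto
    have fst_le: "cmod (fst w) \<le> norm w" and snd_le: "cmod (snd w) \<le> norm w" for w :: "complex \<times> complex"
      using norm_fst_le[of "fst w" "snd w"] norm_snd_le[of "snd w" "fst w"] by simp_all
    have quot: "cmod (quasi_diff p c w t / complex_of_real (p t))
        \<le> norm (w (t + 1)) + norm (w t) + K * norm (w t)" for w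
    proof -
      have "quasi_diff p c w t / complex_of_real (p t) =
          fst (w (t + 1)) - fst (w t) + complex_of_real (c t / p t) * snd (w t)"
        using pt by (simp add: quasi_diff_def fdiff_def field_simps)
      also have "cmod \<dots> \<le> cmod (fst (w (t + 1))) + cmod (fst (w t)) + \<bar>c t / p t\<bar> * cmod (snd (w t))"
        by (rule order_trans[OF norm_triangle_ineq add_mono[OF norm_triangle_ineq4]])
           (simp only: norm_mult norm_of_real order_refl)
      also have "\<dots> \<le> norm (w (t + 1)) + norm (w t) + K * norm (w t)"
        using bound t by (intro add_mono mult_mono fst_le snd_le) (auto simp: K)
      finally show ?thesis .
    qed
    have "1 / complex_of_real (p t) = fst (y (t + 1)) * (quasi_diff p c z t / complex_of_real (p t))
        - (quasi_diff p c y t / complex_of_real (p t)) * fst (z (t + 1))"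
      using wronskian_const[OF y z, of t] t N W unfolding wronskian_def
      by (simp add: diff_divide_distrib[symmetric])
    then have "cmod (1 / complex_of_real (p t)) \<le>
        cmod (fst (y (t + 1)) * (quasi_diff p c z t / complex_of_real (p t))) +
        cmod ((quasi_diff p c y t / complex_of_real (p t)) * fst (z (t + 1)))"
      by (simp only: norm_triangle_ineq4)
    also have "\<dots> \<le> A' * (B' + B + K * B) + (A' + A + K * A) * B'"
      unfolding norm_mult defs
      by (intro add_mono mult_mono fst_le quot) (auto simp: K)
    also have "\<dots> = 2 * A' * B' + (1 + K) * (A' * B + A * B')"
      by (simp add: algebra_simps)
    also have "\<dots> \<le> (g t + g (t + 1)) + (1 + K) * (g t + g (t + 1))"
    proof (rule add_mono[OF _ mult_left_mono])
      have AM: "2 * x * w \<le> x\<^sup>2 + w\<^sup>2" for x w :: real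
        using sum_squares_bound[of x w] by simp
      have sum_g: "g t + g (t + 1) = A\<^sup>2 + B\<^sup>2 + (A'\<^sup>2 + B'\<^sup>2)" by (simp add: g_def defs)
      show "2 * A' * B' \<le> g t + g (t + 1)"
        using AM[of A' B'] zero_le_power2[of A] zero_le_power2[of B] unfolding sum_g by linarith
      show "A' * B + A * B' \<le> g t + g (t + 1)"
      proof -
        have "2 * (A' * B) \<le> A'\<^sup>2 + B\<^sup>2" "2 * (A * B') \<le> A\<^sup>2 + B'\<^sup>2"
          using AM[of A' B] AM[of A B'] by (simp_all only: mult.assoc)
        then show ?thesis
          using zero_le_power2[of A] zero_le_power2[of B] zero_le_power2[of A'] zero_le_power2[of B']
          unfolding sum_g by linarith
      qed
      show "0 \<le> 1 + K" using K by simp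
    qed
    finally show ?thesis by (simp add: norm_divide algebra_simps)
  qed
  have "(\<Sum>t=N..M. 1 / \<bar>p t\<bar>) \<le> 1 / \<bar>p N\<bar> + (2 + K) * (4 * B)" if M: "M \<ge> N" for M
  proof -
    \<comment> \<open>At \<open>t = N\<close> itself no bound on \<open>c / p\<close> is given, so this term is split off.\<close>
    have "{N..M} = insert N {N+1..M}" using M by auto
    then have "(\<Sum>t=N..M. 1 / \<bar>p t\<bar>) = 1 / \<bar>p N\<bar> + (\<Sum>t=N+1..M. 1 / \<bar>p t\<bar>)" by simp
    also have "(\<Sum>t=N+1..M. 1 / \<bar>p t\<bar>) \<le> (\<Sum>t=N+1..M. (2 + K) * (g t + g (t + 1)))"
      by (intro sum_mono term_le) simp
    also have "\<dots> = (2 + K) * ((\<Sum>t=N+1..M. g t) + (\<Sum>t=N+1..M. g (t + 1)))"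
      unfolding sum.distrib[symmetric] sum_distrib_left[symmetric] ..
    also have "(\<Sum>t=N+1..M. g (t + 1)) = (\<Sum>t=N+2..M+1. g t)"
      by (rule sum.reindex_bij_witness[of _ "\<lambda>t. t - 1" "\<lambda>t. t + 1"]) auto
    also have "(2 + K) * ((\<Sum>t=N+1..M. g t) + (\<Sum>t=N+2..M+1. g t)) \<le>
        (2 + K) * ((\<Sum>t=a..M+1. g t) + (\<Sum>t=a..M+1. g t))"
      using N K g0 by (intro mult_left_mono add_mono sum_mono2) auto
    also have "\<dots> \<le> (2 + K) * (4 * B)"
      using g_le[of "M + 1"] K by (intro mult_left_mono) auto
    finally show ?thesis by simp
  qed
  then have le: "\<forall>M\<ge>N. (\<Sum>t=N..M. 1 / \<bar>p t\<bar>) \<le> 1 / \<bar>p N\<bar> + (2 + K) * (4 * B)" by blast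
  have "eventually (\<lambda>M. (\<Sum>t=N..M. 1 / \<bar>p t\<bar>) > 1 / \<bar>p N\<bar> + (2 + K) * (4 * B)) at_top"
    using divergent unfolding filterlim_at_top_dense by (rule spec)
  then obtain M0 where "\<forall>M\<ge>M0. (\<Sum>t=N..M. 1 / \<bar>p t\<bar>) > 1 / \<bar>p N\<bar> + (2 + K) * (4 * B)"
    unfolding eventually_at_top_linorder by (elim exE)
  with le show False
    by (metis linorder_not_less max.cobounded1 max.cobounded2)
qed

end

section \<open>The Weyl discs and their intersection\<close>

lemma weyl_phi_psi_solutions:
  fixes a :: int and p q c h d :: "int \<Rightarrow> real" and \<mu> :: complex and \<alpha> :: real
  assumes "\<forall>t\<ge>a - 1. p t \<noteq> 0" "\<mu> \<notin> \<real>"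
  defines "phi \<equiv> weyl_phi a p q c h d \<mu> \<alpha>" and "psi \<equiv> weyl_psi a p q c h d \<mu> \<alpha>"
  shows "is_solution a p q c h d \<mu> phi" "is_solution a p q c h d \<mu> psi"
    "fst (phi a) = complex_of_real (sin \<alpha>)" "quasi_diff p c phi (a - 1) = - complex_of_real (cos \<alpha>)"
    "fst (psi a) = complex_of_real (cos \<alpha>)" "quasi_diff p c psi (a - 1) = complex_of_real (sin \<alpha>)"
  using theI'[OF ivp_solution_ex1[OF assms(1,2)]]
  unfolding phi_def psi_def weyl_phi_def weyl_psi_def ivp_solution_def by blast+

lemma weyl_phi_psi_wronskian:
  fixes a :: int and p q c h d :: "int \<Rightarrow> real" and \<mu> :: complex and \<alpha> :: real
  assumes "\<forall>t\<ge>a - 1. p t \<noteq> 0" "\<mu> \<notin> \<real>"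
  shows "wronskian p c (weyl_phi a p q c h d \<mu> \<alpha>) (weyl_psi a p q c h d \<mu> \<alpha>) (a - 1) = 1"
proof -
  have "complex_of_real (sin \<alpha>) * complex_of_real (sin \<alpha>) + complex_of_real (cos \<alpha>) * complex_of_real (cos \<alpha>)
      = complex_of_real ((sin \<alpha>)\<^sup>2 + (cos \<alpha>)\<^sup>2)"
    by (simp only: of_real_add of_real_mult power2_eq_square)
  then show ?thesis
    unfolding wronskian_def diff_add_cancel weyl_phi_psi_solutions[OF assms] by simp
qed

lemma wronskian_lin_comb: "wronskian p c (lin_comb y m z) z t = wronskian p c y z t"
  unfolding wronskian_def quasi_diff_lin_comb by (simp add: lin_comb_def algebra_simps)

text \<open>
  At \<open>a\<close> the initial values of \<open>\<phi>\<close> and \<open>\<psi>\<close> make the boundary term in Green's formula equal to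
  \<open>Im m\<close> for \<open>\<phi> + m \<psi>\<close> and to \<open>0\<close> for \<open>\<psi>\<close>. The circle is therefore nondegenerate as soon as \<open>\<psi>\<close> does
  not vanish on all of \<open>{a..N}\<close>. For \<open>N = a\<close> this can fail, since \<open>\<psi>\<^sub>1(a) = cos \<alpha>\<close> may be zero; but
  if \<open>\<psi>\<close> vanished at \<open>a\<close> and \<open>a + 1\<close>, so would the Wronskian at \<open>a\<close>.
\<close>

lemma weyl_disc:
  fixes a N :: int and p q c h d :: "int \<Rightarrow> real" and \<mu> :: complex and \<alpha> :: real
  assumes p: "\<forall>t\<ge>a - 1. p t \<noteq> 0" and l: "\<mu> \<notin> \<real>" and N: "N > a"
  defines "phi \<equiv> weyl_phi a p q c h d \<mu> \<alpha>" and "psi \<equiv> weyl_psi a p q c h d \<mu> \<alpha>"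
  defines "D \<equiv> {m. (\<Sum>t=a..N. (norm (lin_comb phi m psi t))\<^sup>2) \<le> Im m / Im \<mu>}"
  shows "bounded_disc (weyl_circle a p q c h d \<mu> \<alpha> N) = D" "compact D" "D \<noteq> {}"
proof -
  note sol = weyl_phi_psi_solutions[OF p l,
      where q = q and c = c and h = h and d = d and \<alpha> = \<alpha>, folded phi_def psi_def]
  have Im_l: "Im \<mu> \<noteq> 0" using l by (simp add: complex_is_Real_iff)
  have W: "wronskian p c phi psi t = 1" if "t \<ge> a - 1" for t
    using wronskian_const[OF sol(1,2) that] weyl_phi_psi_wronskian[OF p l] by (simp add: phi_def psi_def)
  define A B C E where defs: "A = fst (phi (N + 1))" "B = quasi_diff p c phi N"
    "C = fst (psi (N + 1))" "E = quasi_diff p c psi N"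
  define S where "S = (\<Sum>t=a..N. (norm (psi t))\<^sup>2)"
  have ABCE: "A * E - B * C \<noteq> 0"
    using W[of N] N by (simp add: wronskian_def defs)
  have "S \<noteq> 0"
  proof
    assume "S = 0"
    then have "\<forall>t\<in>{a..N}. (norm (psi t))\<^sup>2 = 0"
      unfolding S_def by (subst (asm) sum_nonneg_eq_0_iff) auto
    then have "psi a = 0" "psi (a + 1) = 0" using N by auto
    then have "wronskian p c phi psi a = 0"
      by (simp add: wronskian_def quasi_diff_def fdiff_def)
    then show False using W[of a] by simp
  qed
  then have S: "S > 0" unfolding S_def by (simp add: sum_nonneg order_less_le)
  have k_eq: "Im (cnj C * E) = - Im \<mu> * S"
    using green_formula[OF sol(2), of N] N sol(5,6) by (simp add: defs S_def)
  have k: "Im (cnj C * E) \<noteq> 0" using k_eq S Im_l by simp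
  have F: "Im (cnj (A + m * C) * (B + m * E)) / Im (cnj C * E) \<le> 0 \<longleftrightarrow> m \<in> D" for m
  proof -
    let ?T = "\<Sum>t=a..N. (norm (lin_comb phi m psi t))\<^sup>2"
    have "Im (cnj (fst (lin_comb phi m psi a)) * quasi_diff p c (lin_comb phi m psi) (a - 1))
        = Im m"
      using arg_cong[OF sin_cos_squared_add3[of \<alpha>], of "\<lambda>x. Im m * x"]
      unfolding quasi_diff_lin_comb lin_comb_def fst_conv sol(3-6) distrib_left
      by (simp add: algebra_simps)
    then have "Im (cnj (A + m * C) * (B + m * E)) = Im m - Im \<mu> * ?T"
      using green_formula[OF is_solution_lin_comb[OF sol(1,2), of m], of N] N
      unfolding quasi_diff_lin_comb by (simp add: lin_comb_def defs)
    also have "\<dots> / Im (cnj C * E) = (?T - Im m / Im \<mu>) / S"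
      unfolding k_eq using S Im_l by (simp add: field_simps)
    finally show ?thesis using S by (simp add: D_def divide_le_0_iff)
  qed
  have "weyl_circle a p q c h d \<mu> \<alpha> N = {m. Im (cnj (A + m * C) * (B + m * E)) = 0}"
    unfolding weyl_circle_def bc_U2_def phi_def[symmetric] psi_def[symmetric] defs[symmetric]
    by (rule moebius_image_real_line[OF k])
  with bounded_disc_hermitian_form[OF k ABCE] show
    "bounded_disc (weyl_circle a p q c h d \<mu> \<alpha> N) = D" "compact D" "D \<noteq> {}"
    unfolding F by simp_all
qed

theorem theorem5p1:
  fixes a N :: int and p q c h d :: "int \<Rightarrow> real" and K :: real
  assumes p_nonzero: "\<forall>t\<ge>a - 1. p t \<noteq> 0"
    and N: "N \<ge> a"
    and bound: "\<forall>t>N. \<bar>c t / p t\<bar> \<le> K"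
    and divergent: "filterlim (\<lambda>M. \<Sum>t=N..M. 1 / \<bar>p t\<bar>) at_top at_top"
  shows "limit_point_case a p q c h d"
  unfolding limit_point_case_def
proof (intro allI impI)
  fix \<mu> :: complex and \<alpha> :: real
  assume l: "\<mu> \<notin> \<real>"
  define phi where "phi = weyl_phi a p q c h d \<mu> \<alpha>"
  define psi where "psi = weyl_psi a p q c h d \<mu> \<alpha>"
  note sol = weyl_phi_psi_solutions[OF p_nonzero l,
      where q = q and c = c and h = h and d = d and \<alpha> = \<alpha>, folded phi_def psi_def]
  define T where "T m M = (\<Sum>t=a..M. (norm (lin_comb phi m psi t))\<^sup>2)" for m M
  define D where "D M = {m. T m M \<le> Im m / Im \<mu>}" for M
  have disc: "bounded_disc (weyl_circle a p q c h d \<mu> \<alpha> M) = D M" "compact (D M)" "D M \<noteq> {}"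
    if "M > a" for M
    using weyl_disc[OF p_nonzero l that,
      where q = q and c = c and h = h and d = d and \<alpha> = \<alpha>] unfolding D_def T_def phi_def psi_def by blast+
  have T_mono: "T m M \<le> T m M'" if "M \<le> M'" for m M M'
    unfolding T_def using that by (intro sum_mono2) auto
  \<comment> \<open>Reindexing by the natural numbers: the discs are nested compact sets only from \<open>a + 1\<close> on.\<close>
  have "\<Inter>(range (\<lambda>n. D (a + 1 + int n))) \<noteq> {}"
  proof (rule compact_nest)
    show "D (a + 1 + int n) \<subseteq> D (a + 1 + int m)" if "m \<le> n" for m n
      using that T_mono[of "a + 1 + int m" "a + 1 + int n"] unfolding D_def
      by (auto intro: order_trans)
  qed (use disc in auto)
  then obtain m where m: "m \<in> D (a + 1 + int n)" for n by blast
  have m_in: "m \<in> D M" if "M > a" for M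
    using m[of "nat (M - a - 1)"] that by simp
  have unique: "m' = m" if m': "m' \<in> (\<Inter>M\<in>{a<..}. D M)" for m'
  proof (rule ccontr)
    assume neq: "m' \<noteq> m"
    have T_le: "T w M \<le> Im w / Im \<mu>" if "\<And>M. M > a \<Longrightarrow> w \<in> D M" for w M
    proof -
      have "w \<in> D (max M (a + 1))" by (rule that) (simp add: less_max_iff_disj)
      then show ?thesis
        using T_mono[of M "max M (a + 1)" w] unfolding D_def by simp
    qed
    define b where "b = Im m / Im \<mu> + Im m' / Im \<mu>"
    have T_m: "T m M \<le> Im m / Im \<mu>" and T_m': "T m' M \<le> Im m' / Im \<mu>" for M
      using m_in m' by (auto intro!: T_le)
    have T0: "T w M \<ge> 0" for w M by (simp add: T_def sum_nonneg)
    define e where "e = (cmod (m' - m))\<^sup>2"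
    have e: "e > 0" using neq by (simp add: e_def)
    \<comment> \<open>\<open>(m' - m) \<psi>\<close> is the difference of two square-summable solutions.\<close>
    have psi_le: "e * (norm (psi t))\<^sup>2 \<le> 2 * (norm (lin_comb phi m psi t))\<^sup>2 + 2 * (norm (lin_comb phi m' psi t))\<^sup>2" for t
    proof -
      have "((m' - m) * fst (psi t), (m' - m) * snd (psi t)) = lin_comb phi m' psi t - lin_comb phi m psi t"
        by (simp add: lin_comb_def algebra_simps)
      then have "norm ((m' - m) * fst (psi t), (m' - m) * snd (psi t)) \<le>
          norm (lin_comb phi m' psi t) + norm (lin_comb phi m psi t)"
        by (metis norm_triangle_ineq4)
      then have "(norm ((m' - m) * fst (psi t), (m' - m) * snd (psi t)))\<^sup>2 \<le>
          (norm (lin_comb phi m' psi t) + norm (lin_comb phi m psi t))\<^sup>2"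
        by (intro power_mono) auto
      also have "\<dots> \<le> 2 * (norm (lin_comb phi m psi t))\<^sup>2 + 2 * (norm (lin_comb phi m' psi t))\<^sup>2"
        using sum_squares_bound[of "norm (lin_comb phi m' psi t)" "norm (lin_comb phi m psi t)"]
        by (simp add: power2_sum)
      finally have "(norm ((m' - m) * fst (psi t), (m' - m) * snd (psi t)))\<^sup>2 \<le> \<dots>" .
      moreover have "(norm ((m' - m) * fst (psi t), (m' - m) * snd (psi t)))\<^sup>2 = e * (norm (psi t))\<^sup>2"
        unfolding norm_prod_def fst_conv snd_conv norm_mult e_def
        by (simp add: power_mult_distrib distrib_left)
      ultimately show ?thesis by simp
    qed
    have psi_bound: "(\<Sum>t=a..M. (norm (psi t))\<^sup>2) \<le> 2 * b / e" for M
    proof -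
      have "e * (\<Sum>t=a..M. (norm (psi t))\<^sup>2) \<le> 2 * T m M + 2 * T m' M"
        unfolding T_def sum_distrib_left sum.distrib[symmetric] by (intro sum_mono psi_le)
      also have "\<dots> \<le> 2 * b" using add_mono[OF T_m T_m', of M M] by (simp add: b_def)
      finally show ?thesis using e by (simp add: field_simps)
    qed
    have chi_bound: "(\<Sum>t=a..M. (norm (lin_comb phi m psi t))\<^sup>2) \<le> b" for M
      using T_m[of M] T_m'[of M] T0[of m' M] unfolding b_def T_def[symmetric] by linarith
    show False
    proof (rule no_square_summable_pair[OF p_nonzero N bound divergent
          is_solution_lin_comb[OF sol(1,2), of m] sol(2)])
      show "wronskian p c (lin_comb phi m psi) psi (a - 1) = 1"
        unfolding wronskian_lin_comb phi_def psi_def by (rule weyl_phi_psi_wronskian[OF p_nonzero l])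
      show "(\<Sum>t=a..M. (norm (lin_comb phi m psi t))\<^sup>2) \<le> max b (2 * b / e)" for M
        using chi_bound[of M] by simp
      show "(\<Sum>t=a..M. (norm (psi t))\<^sup>2) \<le> max b (2 * b / e)" for M
        using psi_bound[of M] by simp
    qed
  qed
  have "(\<Inter>M\<in>{a<..}. bounded_disc (weyl_circle a p q c h d \<mu> \<alpha> M)) = (\<Inter>M\<in>{a<..}. D M)"
    using disc(1) by simp
  also have "\<dots> = {m}" using m_in unique by blast
  finally show "\<exists>m. (\<Inter>M\<in>{a<..}. bounded_disc (weyl_circle a p q c h d \<mu> \<alpha> M)) = {m}" by blast
qed

end
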